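(* Let $k \ge 5$ be an integer and let $G^F(k) = (C \cup (V\setminus C), E)$ be any graph with vertex set $V$ and $C\subseteq V$ such that $|C|=k$, the induced subgraph $G^F(k)[C]$ has neither open nor closed twins, and $V\setminus C$ consists of exactly one vertex $v_{C'}$ with $N(v_{C'})\cap C=C'$ for each non-empty subset $C'\subseteq C$ such that there is no vertex $u\in C$ with either $N(u)\cap C=C'$ or $N[u]\cap C=C'$ (with no condition on the edges inside $V\setminus C$). Then in $G^F(k)$, the set $C$ is a minimum-cardinality (i) FD-code; (ii) FTD-code if $G^F(k)[C]$ has no isolated vertex, that is, if $G^F(k)[C]$ is FTD-admissible. Moreover, for $X \in \{\mathrm{FD}, \mathrm{FTD}\}$, the minimum X-density among all X-admissible graphs with X-number $k$ is attained by the graphs $G^F(k)$ for which $G^F(k)[C]$ has an isolated vertex if $X=\mathrm{FD}$, and by those graphs $G^F(k)$ for which $G^F(k)[C]$ has no isolated vertex if $X=\mathrm{FTD}$.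
   Context: Graphs are finite, simple and undirected. For a graph $G=(V,E)$ and $v\in V$, $N(v)$ is the open neighborhood and $N[v]=N(v)\cup\{v\}$ the closed neighborhood; $G[C]$ is the subgraph induced by $C$. Open twins are distinct non-adjacent vertices $u,v$ with $N(u)=N(v)$; closed twins are distinct adjacent vertices $u,v$ with $N[u]=N[v]$. A set $C\subseteq V$ is dominating (resp. total-dominating) if $N[v]\cap C\neq\emptyset$ (resp. $N(v)\cap C\ne\emptyset$) for all $v\in V$. A set $C$ is full-separating if $N(u)\cap C\neq N(v)\cap C$ and $N[u]\cap C\neq N[v]\cap C$ for all distinct $u,v\in V$. An FD-code (resp. FTD-code) is a set that is full-separating and dominating (resp. total-dominating). A graph is X-admissible if it has an X-code; the X-number $\gamma^{X}(G)$ of an X-admissible graph is the minimum cardinality of an X-code of $G$. The X-density of an X-admissible graph $G$ on $n$ vertices is $\gamma^{X}(G)/n$. *)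

theory Defs
  imports Complex_Main "Graph_Theory.Digraph_Component"
begin

text \<open>
  Finite simple undirected graphs are instances of the locale \<^locale>\<open>graph\<close>: finite symmetric
  digraphs without loops and parallel arcs, where an undirected edge is a pair of opposite arcs.
\<close>

definition nbhd :: "('a, 'b) pre_digraph \<Rightarrow> 'a \<Rightarrow> 'a set" where
  "nbhd G v = {u. v \<rightarrow>\<^bsub>G\<^esub> u}"

definition closed_nbhd :: "('a, 'b) pre_digraph \<Rightarrow> 'a \<Rightarrow> 'a set" where
  "closed_nbhd G v = nbhd G v \<union> {v}"

definition open_twins :: "('a, 'b) pre_digraph \<Rightarrow> 'a \<Rightarrow> 'a \<Rightarrow> bool" where
  "open_twins G u v \<longleftrightarrow>
     u \<in> verts G \<and> v \<in> verts G \<and> u \<noteq> v \<and> v \<notin> nbhd G u \<and> nbhd G u = nbhd G v"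

definition closed_twins :: "('a, 'b) pre_digraph \<Rightarrow> 'a \<Rightarrow> 'a \<Rightarrow> bool" where
  "closed_twins G u v \<longleftrightarrow>
     u \<in> verts G \<and> v \<in> verts G \<and> u \<noteq> v \<and> v \<in> nbhd G u \<and> closed_nbhd G u = closed_nbhd G v"

definition isolated_vertex :: "('a, 'b) pre_digraph \<Rightarrow> 'a \<Rightarrow> bool" where
  "isolated_vertex G v \<longleftrightarrow> v \<in> verts G \<and> nbhd G v = {}"

definition dominating :: "('a, 'b) pre_digraph \<Rightarrow> 'a set \<Rightarrow> bool" where
  "dominating G S \<longleftrightarrow> S \<subseteq> verts G \<and> (\<forall>v\<in>verts G. closed_nbhd G v \<inter> S \<noteq> {})"

definition total_dominating :: "('a, 'b) pre_digraph \<Rightarrow> 'a set \<Rightarrow> bool" where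
  "total_dominating G S \<longleftrightarrow> S \<subseteq> verts G \<and> (\<forall>v\<in>verts G. nbhd G v \<inter> S \<noteq> {})"

definition full_separating :: "('a, 'b) pre_digraph \<Rightarrow> 'a set \<Rightarrow> bool" where
  "full_separating G S \<longleftrightarrow> S \<subseteq> verts G \<and>
     (\<forall>u\<in>verts G. \<forall>v\<in>verts G. u \<noteq> v \<longrightarrow>
        nbhd G u \<inter> S \<noteq> nbhd G v \<inter> S \<and> closed_nbhd G u \<inter> S \<noteq> closed_nbhd G v \<inter> S)"

datatype code_kind = FD | FTD

fun is_code :: "code_kind \<Rightarrow> ('a, 'b) pre_digraph \<Rightarrow> 'a set \<Rightarrow> bool" where
  "is_code FD G S \<longleftrightarrow> full_separating G S \<and> dominating G S"
| "is_code FTD G S \<longleftrightarrow> full_separating G S \<and> total_dominating G S"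

definition admissible :: "code_kind \<Rightarrow> ('a, 'b) pre_digraph \<Rightarrow> bool" where
  "admissible X G \<longleftrightarrow> (\<exists>S. is_code X G S)"

text \<open>The code number and the density are meaningful only for finite admissible graphs.\<close>

definition code_number :: "code_kind \<Rightarrow> ('a, 'b) pre_digraph \<Rightarrow> nat" where
  "code_number X G = Min {card S | S. is_code X G S}"

definition code_density :: "code_kind \<Rightarrow> ('a, 'b) pre_digraph \<Rightarrow> real" where
  "code_density X G = real (code_number X G) / real (card (verts G))"

definition minimum_code :: "code_kind \<Rightarrow> ('a, 'b) pre_digraph \<Rightarrow> 'a set \<Rightarrow> bool" where
  "minimum_code X G S \<longleftrightarrow> is_code X G S \<and> (\<forall>T. is_code X G T \<longrightarrow> card S \<le> card T)"

text \<open>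
  \<open>is_GF k G C\<close>: the graph \<open>G\<close> together with \<open>C\<close> is one of the graphs $G^F(k)$. The bijection says
  that \<open>verts G - C\<close> consists of exactly one vertex with trace \<open>C'\<close> on \<open>C\<close> for each
  non-empty \<open>C' \<subseteq> C\<close> that is not the trace of an open or closed neighborhood of a vertex of \<open>C\<close>.
\<close>

definition is_GF :: "nat \<Rightarrow> ('a, 'b) pre_digraph \<Rightarrow> 'a set \<Rightarrow> bool" where
  "is_GF k G C \<longleftrightarrow> graph G \<and> C \<subseteq> verts G \<and> card C = k \<and>
     \<not> (\<exists>u v. open_twins (G \<restriction> C) u v) \<and> \<not> (\<exists>u v. closed_twins (G \<restriction> C) u v) \<and>
     bij_betw (\<lambda>v. nbhd G v \<inter> C) (verts G - C)
       {C'. C' \<subseteq> C \<and> C' \<noteq> {} \<and>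
            \<not> (\<exists>u\<in>C. nbhd G u \<inter> C = C' \<or> closed_nbhd G u \<inter> C = C')}"

definition extremal_GF :: "code_kind \<Rightarrow> nat \<Rightarrow> ('a, 'b) pre_digraph \<Rightarrow> bool" where
  "extremal_GF X k G \<longleftrightarrow> (\<exists>C. is_GF k G C \<and>
     (case X of FD \<Rightarrow> \<exists>v. isolated_vertex (G \<restriction> C) v
              | FTD \<Rightarrow> \<not> (\<exists>v. isolated_vertex (G \<restriction> C) v)))"

end

theory Submission
  imports Defs "HOL-Library.Nat_Bijection"
begin

text \<open>
  If \<open>S\<close> is full-separating, the traces \<open>N(v) \<inter> S\<close> for \<open>v \<in> V\<close> and \<open>N[v] \<inter> S\<close> for \<open>v \<in> S\<close> are
  pairwise distinct subsets of \<open>S\<close>. Hence \<open>|V| + |S| \<le> 2\<^sup>|\<^sup>S\<^sup>|\<close>, and strictly so for an FTD-code, where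
  no trace is empty. The graphs \<open>G\<^sup>F(k)\<close> realize every non-empty subset of \<open>C\<close> as such a trace, and the
  empty one exactly when some vertex is isolated in \<open>G\<^sup>F(k)[C]\<close>. So they are as large as the bound
  permits, which gives the density claim, and too large to have a code with fewer than \<open>k\<close> vertices.
\<close>

section \<open>Neighborhoods, induced subgraphs and codes\<close>

lemma nbhd_sym: "graph G \<Longrightarrow> u \<in> nbhd G v \<longleftrightarrow> v \<in> nbhd G u"
  unfolding nbhd_def
  by (auto intro: arcs_ends_symmetric sym_digraph.sym_arcs[OF pseudo_graph.axioms(2)[OF graph.axioms(2)]])

lemma not_in_nbhd_self: "graph G \<Longrightarrow> v \<notin> nbhd G v"
  unfolding nbhd_def
  using loopfree_digraph.adj_not_same[OF digraph.axioms(2)[OF graph.axioms(1)]] by auto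

lemma finite_verts_graph: "graph G \<Longrightarrow> finite (verts G)"
  by (rule fin_digraph.finite_verts[OF digraph.axioms(1)[OF graph.axioms(1)]])

lemma nbhd_induce_subgraph: "nbhd (G \<restriction> C) v = (if v \<in> C then nbhd G v \<inter> C else {})"
  by (auto simp: nbhd_def arcs_ends_conv image_iff)

lemma closed_nbhd_induce_subgraph: "v \<in> C \<Longrightarrow> closed_nbhd (G \<restriction> C) v = closed_nbhd G v \<inter> C"
  by (auto simp: closed_nbhd_def nbhd_induce_subgraph)

lemma is_code_full_separating: "is_code X G S \<Longrightarrow> full_separating G S"
  by (cases X) auto

lemma is_code_subset: "is_code X G S \<Longrightarrow> S \<subseteq> verts G"
  using is_code_full_separating unfolding full_separating_def by blast

lemma is_code_FTD_imp_FD: "is_code FTD G S \<Longrightarrow> is_code FD G S"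
  by (auto simp: total_dominating_def dominating_def closed_nbhd_def)

section \<open>Traces and the bounds on the order\<close>

text \<open>For \<open>v\<close> outside \<open>S\<close> the closed trace equals the open one, so
  closed neighborhoods are taken only at vertices of \<open>S\<close>.\<close>

definition traces :: "('a, 'b) pre_digraph \<Rightarrow> 'a set \<Rightarrow> 'a set set" where
  "traces G S = (\<lambda>v. nbhd G v \<inter> S) ` verts G \<union> (\<lambda>v. closed_nbhd G v \<inter> S) ` S"

lemma traces_subset_Pow: "traces G S \<subseteq> Pow S"
  by (auto simp: traces_def)

text \<open>Full separation makes both families injective. They are also disjoint: if the open trace
  of \<open>u\<close> were the closed trace of some \<open>v\<close> in \<open>S\<close>, then
  \<open>u\<close> and \<open>v\<close> would be adjacent with \<open>u\<close> outside
  \<open>S\<close>, and their closed traces would agree.\<close>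

lemma card_traces:
  assumes "graph G" and S: "full_separating G S"
  shows "card (traces G S) = card (verts G) + card S"
proof -
  have sub: "S \<subseteq> verts G"
    using S by (simp add: full_separating_def)
  have fin: "finite (verts G)" "finite S"
    using finite_verts_graph[OF assms(1)] sub finite_subset by blast+
  have "inj_on (\<lambda>v. nbhd G v \<inter> S) (verts G)" "inj_on (\<lambda>v. closed_nbhd G v \<inter> S) S"
    using S sub unfolding inj_on_def full_separating_def by blast+
  moreover have "nbhd G u \<inter> S \<noteq> closed_nbhd G v \<inter> S" if "u \<in> verts G" "v \<in> S" for u v
  proof
    assume eq: "nbhd G u \<inter> S = closed_nbhd G v \<inter> S"
    then have v: "v \<in> nbhd G u"
      using that by (auto simp: closed_nbhd_def)
    then have "u \<noteq> v"
      using not_in_nbhd_self[OF assms(1)] by blast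
    \<comment> \<open>If \<open>u\<close> were in \<open>S\<close>, then, being adjacent to
      \<open>v\<close>, it would lie in the closed trace of \<open>v\<close> and hence in its own
      neighborhood.\<close>
    moreover have "u \<notin> S"
      using v eq nbhd_sym[OF assms(1)] not_in_nbhd_self[OF assms(1)]
      unfolding closed_nbhd_def by blast
    then have "closed_nbhd G u \<inter> S = closed_nbhd G v \<inter> S"
      using eq by (auto simp: closed_nbhd_def)
    ultimately show False
      using S that sub unfolding full_separating_def by blast
  qed
  ultimately show ?thesis
    unfolding traces_def using fin
    by (subst card_Un_disjoint) (auto simp: card_image)
qed

lemma FD_code_order_bound:
  assumes "graph G" "is_code FD G S"
  shows "card (verts G) + card S \<le> 2 ^ card S"
proof -
  have "finite S"
    by (rule finite_subset[OF is_code_subset[OF assms(2)] finite_verts_graph[OF assms(1)]])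
  then show ?thesis
    using card_mono[OF _ traces_subset_Pow, of S G] card_traces[OF assms(1), of S] assms
    by (simp add: card_Pow)
qed

lemma FTD_code_order_bound:
  assumes "graph G" "is_code FTD G S"
  shows "card (verts G) + card S < 2 ^ card S"
proof -
  have fin: "finite S"
    by (rule finite_subset[OF is_code_subset[OF assms(2)] finite_verts_graph[OF assms(1)]])
  have "{} \<notin> traces G S"
    using assms by (auto simp: traces_def total_dominating_def closed_nbhd_def)
  then have "traces G S \<subset> Pow S"
    using traces_subset_Pow[of G S] by auto
  then show ?thesis
    using psubset_card_mono[of "Pow S" "traces G S"] card_traces[OF assms(1), of S] assms fin
    by (simp add: card_Pow)
qed

section \<open>Codes and order of the graphs G^F(k)\<close>

lemma is_GF_basics:
  assumes "is_GF k G C"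
  shows "graph G" "C \<subseteq> verts G" "card C = k"
  using assms by (simp_all only: is_GF_def)

lemma is_GF_bij:
  assumes "is_GF k G C"
  shows "bij_betw (\<lambda>v. nbhd G v \<inter> C) (verts G - C)
       {C'. C' \<subseteq> C \<and> C' \<noteq> {} \<and>
            \<not> (\<exists>u\<in>C. nbhd G u \<inter> C = C' \<or> closed_nbhd G u \<inter> C = C')}"
  using assms unfolding is_GF_def by (elim conjE)

text \<open>Two vertices of \<open>C\<close> are separated because the induced subgraph has no
  twins, two outer vertices because their traces differ, and a mixed pair because outer traces avoid
  the open and closed traces of vertices of \<open>C\<close>.\<close>

lemma is_GF_full_separating:
  assumes GF: "is_GF k G C"
  shows "full_separating G C"
proof -
  have G: "graph G" and sub: "C \<subseteq> verts G"
    and ot: "\<And>u v. \<not> open_twins (G \<restriction> C) u v" and ct: "\<And>u v. \<not> closed_twins (G \<restriction> C) u v"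
    using GF unfolding is_GF_def by blast+
  note bij = is_GF_bij[OF GF]
  have inner: "nbhd G u \<inter> C \<noteq> nbhd G v \<inter> C \<and> closed_nbhd G u \<inter> C \<noteq> closed_nbhd G v \<inter> C"
    if "u \<in> C" "v \<in> C" "u \<noteq> v" for u v
  proof
    show "nbhd G u \<inter> C \<noteq> nbhd G v \<inter> C"
    proof
      assume eq: "nbhd G u \<inter> C = nbhd G v \<inter> C"
      \<comment> \<open>Equal open traces exclude adjacency, since \<open>v\<close> is not its own
        neighbor; the pair would then be open twins.\<close>
      then have "v \<notin> nbhd G u"
        using not_in_nbhd_self[OF G, of v] that(2) by blast
      then show False
        using ot[of u v] that eq not_in_nbhd_self[OF G, of v]
        by (simp add: open_twins_def nbhd_induce_subgraph)
    qed
    show "closed_nbhd G u \<inter> C \<noteq> closed_nbhd G v \<inter> C"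
    proof
      assume eq: "closed_nbhd G u \<inter> C = closed_nbhd G v \<inter> C"
      \<comment> \<open>Equal closed traces force adjacency, so the pair would be closed
        twins.\<close>
      have "v \<in> closed_nbhd G v \<inter> C"
        using that by (simp add: closed_nbhd_def)
      then have "v \<in> closed_nbhd G u"
        unfolding eq[symmetric] by (rule IntD1)
      then have "v \<in> nbhd G u"
        using that(3) by (simp add: closed_nbhd_def)
      then show False
        using ct[of u v] that eq
        by (simp add: closed_twins_def nbhd_induce_subgraph closed_nbhd_induce_subgraph)
    qed
  qed
  have outer: "nbhd G v \<inter> C \<noteq> nbhd G u \<inter> C \<and> nbhd G v \<inter> C \<noteq> closed_nbhd G u \<inter> C"
    if "v \<in> verts G - C" "u \<in> C" for u v
    using bij_betw_apply[OF bij that(1)] that(2) unfolding mem_Collect_eq by metis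
  have inj: "inj_on (\<lambda>v. nbhd G v \<inter> C) (verts G - C)"
    by (rule bij_betw_imp_inj_on[OF bij])
  have closed: "closed_nbhd G v \<inter> C = nbhd G v \<inter> C" if "v \<notin> C" for v
    using that by (auto simp: closed_nbhd_def)
  have "nbhd G u \<inter> C \<noteq> nbhd G v \<inter> C \<and> closed_nbhd G u \<inter> C \<noteq> closed_nbhd G v \<inter> C"
    if "u \<in> verts G" "v \<in> verts G" "u \<noteq> v" for u v
  proof (cases "u \<in> C"; cases "v \<in> C")
    assume "u \<notin> C" "v \<notin> C"
    then show ?thesis
      using inj_onD[OF inj, of u v] that closed by auto
  qed (use inner[of u v] outer[of u v] outer[of v u] that closed in auto)
  then show ?thesis
    using sub unfolding full_separating_def by blast
qed

lemma is_GF_outer_nonempty: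
  assumes "is_GF k G C" "v \<in> verts G - C"
  shows "nbhd G v \<inter> C \<noteq> {}"
  using bij_betw_apply[OF is_GF_bij[OF assms(1)] assms(2)] by simp

lemma isolated_vertex_induce_subgraph:
  "isolated_vertex (G \<restriction> C) v \<longleftrightarrow> v \<in> C \<and> nbhd G v \<inter> C = {}"
  by (auto simp: isolated_vertex_def nbhd_induce_subgraph)

lemma is_GF_FD_code:
  assumes "is_GF k G C"
  shows "is_code FD G C"
proof -
  have "full_separating G C"
    by (rule is_GF_full_separating[OF assms])
  moreover have "closed_nbhd G v \<inter> C \<noteq> {}" if "v \<in> verts G" for v
    using is_GF_outer_nonempty[OF assms, of v] that unfolding closed_nbhd_def by blast
  ultimately show ?thesis
    by (simp add: dominating_def full_separating_def)
qed

lemma is_GF_FTD_code: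
  assumes "is_GF k G C" "\<not> (\<exists>v. isolated_vertex (G \<restriction> C) v)"
  shows "is_code FTD G C"
proof -
  have "full_separating G C"
    by (rule is_GF_full_separating[OF assms(1)])
  moreover have "nbhd G v \<inter> C \<noteq> {}" if "v \<in> verts G" for v
    using is_GF_outer_nonempty[OF assms(1), of v] assms(2) that
    unfolding isolated_vertex_induce_subgraph by blast
  ultimately show ?thesis
    by (simp add: total_dominating_def full_separating_def)
qed

text \<open>A non-empty subset of \<open>C\<close> that is no trace of a vertex of \<open>C\<close>
  is by construction the trace of an outer vertex. Outer traces are non-empty and closed traces
  contain their own vertex, so the empty set arises only from an isolated vertex.\<close>

lemma is_GF_traces:
  assumes "is_GF k G C"
  shows "traces G C = Pow C - (if \<exists>v. isolated_vertex (G \<restriction> C) v then {} else {{}})"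
proof -
  have sub: "C \<subseteq> verts G"
    by (rule is_GF_basics(2)[OF assms])
  have img: "(\<lambda>v. nbhd G v \<inter> C) ` (verts G - C) =
       {C'. C' \<subseteq> C \<and> C' \<noteq> {} \<and>
            \<not> (\<exists>u\<in>C. nbhd G u \<inter> C = C' \<or> closed_nbhd G u \<inter> C = C')}"
    by (rule bij_betw_imp_surj_on[OF is_GF_bij[OF assms]])
  have "A \<in> traces G C" if "A \<subseteq> C" "A \<noteq> {}" for A
  proof (cases "\<exists>u\<in>C. nbhd G u \<inter> C = A \<or> closed_nbhd G u \<inter> C = A")
    case True
    then show ?thesis using sub unfolding traces_def by blast
  next
    case False
    then have "A \<in> (\<lambda>v. nbhd G v \<inter> C) ` (verts G - C)"
      using that img by blast
    then show ?thesis unfolding traces_def by blast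
  qed
  moreover have "{} \<in> traces G C \<longleftrightarrow> (\<exists>v. isolated_vertex (G \<restriction> C) v)"
    using is_GF_outer_nonempty[OF assms] sub
    unfolding traces_def isolated_vertex_induce_subgraph closed_nbhd_def by blast
  ultimately show ?thesis
    using traces_subset_Pow[of G C] by auto
qed

lemma is_GF_order:
  assumes "is_GF k G C" "k > 0"
  shows "card (verts G) + k = 2 ^ k - (if \<exists>v. isolated_vertex (G \<restriction> C) v then 0 else 1)"
proof -
  have G: "graph G" and k: "card C = k"
    using is_GF_basics[OF assms(1)] by simp_all
  \<comment> \<open>Infinite sets have \<open>card\<close> 0, so \<open>k > 0\<close> makes
    \<open>C\<close> finite.\<close>
  have "finite C"
    using k assms(2) card_ge_0_finite by blast
  then have "card (traces G C) = 2 ^ k - (if \<exists>v. isolated_vertex (G \<restriction> C) v then 0 else 1)"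
    using k unfolding is_GF_traces[OF assms(1)] by (auto simp: card_Pow card_Diff_subset)
  then show ?thesis
    using card_traces[OF G is_GF_full_separating[OF assms(1)]] k by simp
qed

section \<open>Minimality of the set C\<close>

text \<open>A code with \<open>t < k\<close> vertices bounds the order of \<open>G\<close> by
  \<open>2 ^ t - t\<close>, while \<open>G\<close> has at least \<open>2 ^ k - k - 1\<close>
  vertices. With \<open>k = t + d + 1\<close> this gives
  \<open>2 * 2 ^ (t + d) \<le> 2 ^ t + d + 2 \<le> 2 ^ (t + d) + 2\<close>, which fails since
  \<open>2 ^ (t + d)\<close> is at least 16.\<close>

lemma is_GF_card_le_code:
  assumes "is_GF k G C" "k \<ge> 5" "is_code FD G T"
  shows "card C \<le> card T"
proof (rule ccontr)
  define t where "t = card T"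
  have G: "graph G" and k: "card C = k"
    using is_GF_basics[OF assms(1)] by simp_all
  assume "\<not> card C \<le> card T"
  then obtain d where d: "k = Suc (t + d)"
    using k less_imp_Suc_add[of "card T" k] by (auto simp: t_def not_le)
  have "card (verts G) + t \<le> 2 ^ t"
    using FD_code_order_bound[OF G assms(3)] by (simp add: t_def)
  \<comment> \<open>The summand 1 covers the case without isolated vertex, where the empty trace is
    missing.\<close>
  moreover have "2 ^ k \<le> card (verts G) + k + 1"
    using is_GF_order[OF assms(1)] assms(2) by (simp split: if_splits)
  moreover have "(2::nat) ^ (t + d) \<ge> 2 ^ t + d"
  proof (induction d)
    case (Suc d)
    have "(1::nat) \<le> 2 ^ (t + d)"
      by simp
    with Suc show ?case
      unfolding add_Suc_right power_Suc by linarith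
  qed simp
  moreover have "(2::nat) ^ 4 \<le> 2 ^ (t + d)"
    using assms(2) d by (intro power_increasing) auto
  ultimately show False
    by (simp add: d)
qed

text \<open>Every FTD-code is an FD-code, so the bound for FD-codes settles both kinds.\<close>

lemma is_GF_minimum_code:
  assumes "is_GF k G C" "k \<ge> 5" "is_code X G C"
  shows "minimum_code X G C"
proof -
  have "card C \<le> card T" if "is_code X G T" for T
  proof (rule is_GF_card_le_code[OF assms(1,2)])
    show "is_code FD G T"
      using that is_code_FTD_imp_FD by (cases X) auto
  qed
  then show ?thesis
    using assms(3) by (simp add: minimum_code_def)
qed

text \<open>An isolated vertex has an empty neighborhood, which no set can meet. Without one,
  \<open>C\<close> itself is an FTD-code of the induced subgraph, where its vertices have the same
  traces on \<open>C\<close> as in \<open>G\<close>.\<close>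

lemma is_GF_admissible_FTD_induced:
  assumes "is_GF k G C"
  shows "\<not> (\<exists>v. isolated_vertex (G \<restriction> C) v) \<longleftrightarrow> admissible FTD (G \<restriction> C)"
proof
  assume "admissible FTD (G \<restriction> C)"
  then show "\<not> (\<exists>v. isolated_vertex (G \<restriction> C) v)"
    by (auto simp: admissible_def total_dominating_def isolated_vertex_def)
next
  assume no_iso: "\<not> (\<exists>v. isolated_vertex (G \<restriction> C) v)"
  have "full_separating (G \<restriction> C) C"
    using is_GF_full_separating[OF assms]
    by (auto simp: full_separating_def nbhd_induce_subgraph closed_nbhd_induce_subgraph subset_iff)
  moreover have "total_dominating (G \<restriction> C) C"
    using no_iso
    by (auto simp: total_dominating_def nbhd_induce_subgraph isolated_vertex_induce_subgraph)
  ultimately show "admissible FTD (G \<restriction> C)"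
    unfolding admissible_def by (auto intro: exI[of _ C])
qed

section \<open>Code numbers and densities\<close>

text \<open>Finiteness is what lets the \<open>Min\<close> in \<open>code_number\<close> denote an
  actual minimum.\<close>

lemma finite_code_cards:
  assumes "graph G"
  shows "finite {card S | S. is_code X G S}"
proof (rule finite_subset)
  show "{card S | S. is_code X G S} \<subseteq> {..card (verts G)}"
    by (auto intro!: card_mono finite_verts_graph[OF assms] is_code_subset simp del: is_code.simps)
qed simp

lemma code_number_attained:
  assumes "graph G" "admissible X G"
  obtains S where "is_code X G S" "card S = code_number X G"
proof -
  have "code_number X G \<in> {card S | S. is_code X G S}"
    unfolding code_number_def
    using assms by (intro Min_in finite_code_cards) (auto simp: admissible_def)
  then show ?thesis
    using that by auto
qed

lemma code_number_minimum_code: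
  assumes "graph G" "minimum_code X G C"
  shows "code_number X G = card C"
  unfolding code_number_def
  using assms by (intro Min_eqI finite_code_cards) (auto simp: minimum_code_def)

lemma extremal_GF_properties:
  assumes "extremal_GF X k G" "k \<ge> 5"
  shows "graph G" "admissible X G" "code_number X G = k"
    and "card (verts G) + k = 2 ^ k - (case X of FD \<Rightarrow> 0 | FTD \<Rightarrow> 1)"
proof -
  obtain C where GF: "is_GF k G C"
    and iso: "case X of FD \<Rightarrow> \<exists>v. isolated_vertex (G \<restriction> C) v
              | FTD \<Rightarrow> \<not> (\<exists>v. isolated_vertex (G \<restriction> C) v)"
    using assms unfolding extremal_GF_def by blast
  have code: "is_code X G C"
    using iso is_GF_FD_code[OF GF] is_GF_FTD_code[OF GF] by (cases X) simp_all
  show G: "graph G"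
    by (rule is_GF_basics(1)[OF GF])
  show "admissible X G"
    using code admissible_def by blast
  show "code_number X G = k"
    using code_number_minimum_code[OF G is_GF_minimum_code[OF GF assms(2) code]] is_GF_basics(3)[OF GF]
    by simp
  show "card (verts G) + k = 2 ^ k - (case X of FD \<Rightarrow> 0 | FTD \<Rightarrow> 1)"
    using is_GF_order[OF GF] iso assms(2) by (cases X) auto
qed

text \<open>Both densities have numerator \<open>k\<close>, so only the orders matter: a minimum
  code of \<open>H\<close> bounds the order of \<open>H\<close> by the value that \<open>G\<close>
  attains.\<close>

lemma extremal_GF_density_le:
  assumes G: "extremal_GF X k G" "k \<ge> 5"
    and H: "graph H" "admissible X H" "code_number X H = k"
  shows "code_density X G \<le> code_density X H"
proof -
  obtain S where S: "is_code X H S" "card S = k"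
    using code_number_attained[OF H(1,2)] H(3) by metis
  \<comment> \<open>As \<open>card S = k\<close>, the order of \<open>H\<close> is positive, which
    comparing the quotients requires.\<close>
  have "card S \<le> card (verts H)"
    by (rule card_mono[OF finite_verts_graph[OF H(1)] is_code_subset[OF S(1)]])
  moreover have "card (verts H) + k \<le> 2 ^ k - (case X of FD \<Rightarrow> 0 | FTD \<Rightarrow> 1)"
    using FD_code_order_bound[OF H(1), of S] FTD_code_order_bound[OF H(1), of S] S
    by (cases X) auto
  then have "card (verts H) \<le> card (verts G)"
    using extremal_GF_properties(4)[OF G] by simp
  ultimately show ?thesis
    unfolding code_density_def
    using extremal_GF_properties(3)[OF G] H(3) S(2) G(2) by (simp add: frac_le)
qed

section \<open>Explicit graphs G^F(k) and existence\<close>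

text \<open>The traces to be realized outside \<open>C = {..<k}\<close> when \<open>R\<close> is the
  adjacency on \<open>C\<close>. They are expressed through \<open>R\<close> alone because the graph
  is built from them.\<close>

definition GF_traces :: "nat \<Rightarrow> (nat \<Rightarrow> nat \<Rightarrow> bool) \<Rightarrow> nat set set" where
  "GF_traces k R = {A. A \<subseteq> {..<k} \<and> A \<noteq> {} \<and>
     \<not> (\<exists>u<k. {v. v < k \<and> R u v} = A \<or> insert u {v. v < k \<and> R u v} = A)}"

text \<open>The number \<open>k + set_encode A\<close> serves as the vertex outside \<open>C = {..<k}\<close> with trace \<open>A\<close>.\<close>

definition GF_edges :: "nat \<Rightarrow> (nat \<Rightarrow> nat \<Rightarrow> bool) \<Rightarrow> (nat \<times> nat) set" where
  "GF_edges k R = {(u, v). u < k \<and> v < k \<and> R u v} \<union>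
     (\<Union>A\<in>GF_traces k R. {(u, k + set_encode A) | u. u \<in> A} \<union> {(k + set_encode A, u) | u. u \<in> A})"

text \<open>Arcs are ordered pairs, so parallel arcs cannot occur. Outer vertices are pairwise
  non-adjacent, one of the choices that \<open>is_GF\<close> leaves open.\<close>

definition GF_graph :: "nat \<Rightarrow> (nat \<Rightarrow> nat \<Rightarrow> bool) \<Rightarrow> (nat, nat \<times> nat) pre_digraph" where
  "GF_graph k R = \<lparr>verts = {..<k} \<union> (\<lambda>A. k + set_encode A) ` GF_traces k R,
     arcs = GF_edges k R, tail = fst, head = snd\<rparr>"

lemma GF_tracesD: "A \<in> GF_traces k R \<Longrightarrow> A \<subseteq> {..<k}"
  by (simp add: GF_traces_def)

lemma finite_GF_traces: "finite (GF_traces k R)"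
  by (rule finite_subset[of _ "Pow {..<k}"]) (auto simp: GF_traces_def)

text \<open>\<open>set_encode\<close> is injective on finite sets, and every trace is a subset of
  \<open>{..<k}\<close>.\<close>

lemma inj_on_GF_traces: "inj_on (\<lambda>A. k + set_encode A) (GF_traces k R)"
proof -
  have "GF_traces k R \<subseteq> Collect finite"
    using finite_subset[OF GF_tracesD] by blast
  then show ?thesis
    using inj_on_subset[OF inj_on_set_encode] by (auto simp: inj_on_def)
qed

lemma arcs_ends_GF_graph: "arcs_ends (GF_graph k R) = GF_edges k R"
  by (auto simp: arcs_ends_conv GF_graph_def)

lemma nbhd_GF_graph_inner:
  assumes "u < k"
  shows "nbhd (GF_graph k R) u \<inter> {..<k} = {v. v < k \<and> R u v}"
  using assms GF_tracesD[of _ k R] by (fastforce simp: nbhd_def arcs_ends_GF_graph GF_edges_def)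

text \<open>A number \<open>k + set_encode A\<close> is never below \<open>k\<close>, and by
  injectivity of the encoding only \<open>A\<close> contributes arcs leaving it.\<close>

lemma nbhd_GF_graph_outer:
  assumes "A \<in> GF_traces k R"
  shows "nbhd (GF_graph k R) (k + set_encode A) \<inter> {..<k} = A"
proof -
  have A: "A \<subseteq> {..<k}"
    by (rule GF_tracesD[OF assms])
  moreover have "B = A" if "B \<in> GF_traces k R" "set_encode A = set_encode B" for B
    using inj_onD[OF inj_on_GF_traces[of k R], of B A] that assms by simp
  ultimately show ?thesis
    using assms by (auto simp: nbhd_def arcs_ends_GF_graph GF_edges_def)
qed

lemma graph_GF_graph:
  assumes "\<And>u v. R u v \<Longrightarrow> R v u" "\<And>u. \<not> R u u"
  shows "graph (GF_graph k R)"
proof -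
  let ?G = "GF_graph k R"
  have simps: "arcs ?G = GF_edges k R" "tail ?G = fst" "head ?G = snd"
    by (simp_all add: GF_graph_def)
  have fin: "finite (verts ?G)"
    by (simp add: GF_graph_def finite_GF_traces)
  have sub: "GF_edges k R \<subseteq> verts ?G \<times> verts ?G"
    using GF_tracesD[of _ k R] by (fastforce simp: GF_edges_def GF_graph_def)
  have loopfree: "(u, u) \<notin> GF_edges k R" for u
    using assms(2) GF_tracesD[of _ k R] by (fastforce simp: GF_edges_def)
  have swap: "(v, u) \<in> GF_edges k R" if "(u, v) \<in> GF_edges k R" for u v
    using that assms(1) unfolding GF_edges_def by blast
  show ?thesis
  proof unfold_locales
    show "tail ?G e \<in> verts ?G" "head ?G e \<in> verts ?G" if "e \<in> arcs ?G" for e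
      using that sub unfolding simps by auto
    show "tail ?G e \<noteq> head ?G e" if "e \<in> arcs ?G" for e
      using that loopfree[of "fst e"] unfolding simps by (metis prod.collapse)
    show "e1 = e2" if "arc_to_ends ?G e1 = arc_to_ends ?G e2" for e1 e2
      using that unfolding arc_to_ends_def simps by (simp add: prod_eq_iff)
    show "finite (arcs ?G)"
      using finite_subset[OF sub] fin unfolding simps by simp
    show "symmetric ?G"
      unfolding symmetric_def arcs_ends_GF_graph by (rule symI) (rule swap)
  qed (rule fin)
qed

text \<open>Reduces the construction to two separation conditions on \<open>R\<close> inside
  \<open>C\<close>. Requiring them for \<open>u < v\<close> suffices, as both are symmetric in
  \<open>u\<close> and \<open>v\<close>.\<close>

lemma is_GF_GF_graph:
  assumes R: "\<And>u v. R u v \<Longrightarrow> R v u" "\<And>u. \<not> R u u"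
    and open_sep: "\<And>u v. u < v \<Longrightarrow> v < k \<Longrightarrow> \<exists>w<k. R u w \<noteq> R v w"
    and closed_sep: "\<And>u v. u < v \<Longrightarrow> v < k \<Longrightarrow> \<exists>w<k. (w = u \<or> R u w) \<noteq> (w = v \<or> R v w)"
  shows "is_GF k (GF_graph k R) {..<k}"
proof -
  let ?G = "GF_graph k R" and ?C = "{..<k}"
  have nb: "nbhd ?G u \<inter> ?C = {v. v < k \<and> R u v}"
    "closed_nbhd ?G u \<inter> ?C = insert u {v. v < k \<and> R u v}" if "u < k" for u
    using nbhd_GF_graph_inner[OF that] that by (auto simp: closed_nbhd_def)
  have open_free: "\<not> open_twins (?G \<restriction> ?C) u v" for u v
  proof
    assume twins: "open_twins (?G \<restriction> ?C) u v"
    then have uv: "u < k" "v < k" "u \<noteq> v"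
      by (simp_all add: open_twins_def)
    moreover have "{w. w < k \<and> R u w} = {w. w < k \<and> R v w}"
      using twins uv by (simp add: open_twins_def nbhd_induce_subgraph nb(1))
    then have "R u w \<longleftrightarrow> R v w" if "w < k" for w
      using that by blast
    ultimately show False
      using open_sep[of u v] open_sep[of v u] by (meson linorder_neqE_nat)
  qed
  have closed_free: "\<not> closed_twins (?G \<restriction> ?C) u v" for u v
  proof
    assume twins: "closed_twins (?G \<restriction> ?C) u v"
    then have uv: "u < k" "v < k" "u \<noteq> v"
      by (simp_all add: closed_twins_def)
    have "insert u {w. w < k \<and> R u w} = insert v {w. w < k \<and> R v w}"
      using twins uv by (simp add: closed_twins_def closed_nbhd_induce_subgraph nb(2))
    then have eq: "w = u \<or> R u w \<longleftrightarrow> w = v \<or> R v w" if "w < k" for w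
      using that by blast
    show False
      using closed_sep[of u v] closed_sep[of v u] uv eq by (meson linorder_neqE_nat)
  qed
  have bij: "bij_betw (\<lambda>v. nbhd ?G v \<inter> ?C) (verts ?G - ?C) (GF_traces k R)"
  proof -
    have "verts ?G - ?C = (\<lambda>A. k + set_encode A) ` GF_traces k R"
      by (auto simp: GF_graph_def)
    then show ?thesis
      using nbhd_GF_graph_outer[of _ k R]
      by (intro bij_betw_byWitness[where f' = "\<lambda>A. k + set_encode A"]) auto
  qed
  have "(\<exists>u\<in>?C. nbhd ?G u \<inter> ?C = A \<or> closed_nbhd ?G u \<inter> ?C = A) \<longleftrightarrow>
      (\<exists>u<k. {v. v < k \<and> R u v} = A \<or> insert u {v. v < k \<and> R u v} = A)" for A
    unfolding Bex_def lessThan_iff by (intro ex_cong1 conj_cong refl) (simp only: nb)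
  then have eq: "GF_traces k R = {C'. C' \<subseteq> ?C \<and> C' \<noteq> {} \<and>
      \<not> (\<exists>u\<in>?C. nbhd ?G u \<inter> ?C = C' \<or> closed_nbhd ?G u \<inter> ?C = C')}"
    unfolding GF_traces_def by (simp only:)
  show ?thesis
    unfolding is_GF_def eq[symmetric]
  proof (intro conjI)
    show "graph ?G"
      by (rule graph_GF_graph[OF R])
    show "?C \<subseteq> verts ?G"
      by (simp add: GF_graph_def)
    show "\<not> (\<exists>u v. open_twins (?G \<restriction> ?C) u v)" "\<not> (\<exists>u v. closed_twins (?G \<restriction> ?C) u v)"
      using open_free closed_free by blast+
  qed (simp, rule bij)
qed

text \<open>\<open>R\<close> is a path on \<open>m \<ge> 4\<close> vertices; if \<open>k = Suc m\<close>, the vertex \<open>m\<close> is isolated.\<close>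

lemma is_GF_path:
  assumes "4 \<le> m" "m \<le> k" "k \<le> Suc m"
  defines "R \<equiv> \<lambda>u v. u < m \<and> v < m \<and> (v = Suc u \<or> u = Suc v)"
  shows "is_GF k (GF_graph k R) {..<k}"
proof (rule is_GF_GF_graph)
  fix u v assume uv: "u < v" "v < k"
  \<comment> \<open>The vertex \<open>u - 1\<close> is adjacent to \<open>u\<close> but not to the
    larger \<open>v\<close>. For \<open>u = 0\<close> the vertex 1 takes its place, its neighbors
    being 0 and 2; the pair 0, 2 is separated by 3, which lies on the path because
    \<open>4 \<le> m\<close>.\<close>
  consider "u = 0" | "u > 0"
    by auto
  then show "\<exists>w<k. R u w \<noteq> R v w"
  proof cases
    case 1
    show ?thesis
    proof (cases "v = 2")
      case True
      with 1 uv assms show ?thesis by (intro exI[of _ 3]) (simp add: R_def)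
    next
      case False
      with 1 uv assms show ?thesis by (intro exI[of _ 1]) (auto simp: R_def)
    qed
  next
    case 2
    with uv assms show ?thesis by (intro exI[of _ "u - 1"]) (auto simp: R_def)
  qed
  \<comment> \<open>The vertex \<open>u\<close> itself separates unless \<open>v\<close> is its
    successor; then \<open>u - 1\<close> does, or 2 when \<open>u = 0\<close>.\<close>
  show "\<exists>w<k. (w = u \<or> R u w) \<noteq> (w = v \<or> R v w)"
  proof (cases "v = Suc u")
    case False
    with uv assms show ?thesis by (intro exI[of _ u]) (auto simp: R_def)
  next
    case True
    show ?thesis
    proof (cases "u = 0")
      case True
      with \<open>v = Suc u\<close> uv assms show ?thesis by (intro exI[of _ 2]) (auto simp: R_def)
    next
      case False
      with \<open>v = Suc u\<close> uv assms show ?thesis by (intro exI[of _ "u - 1"]) (auto simp: R_def)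
    qed
  qed
qed (auto simp: R_def)

text \<open>For FD, \<open>C\<close> induces a path on \<open>k - 1\<close> vertices plus an
  isolated vertex; for FTD, a path on \<open>k\<close> vertices. The bound \<open>k \<ge> 5\<close>
  leaves at least four path vertices in either case.\<close>

lemma extremal_GF_exists:
  assumes "k \<ge> 5"
  shows "\<exists>G :: (nat, nat \<times> nat) pre_digraph. extremal_GF X k G"
proof (cases X)
  case FD
  let ?G = "GF_graph k (\<lambda>u v. u < k - 1 \<and> v < k - 1 \<and> (v = Suc u \<or> u = Suc v))"
  have "is_GF k ?G {..<k}"
    using assms by (intro is_GF_path) auto
  moreover have "isolated_vertex (?G \<restriction> {..<k}) (k - 1)"
    using assms by (auto simp: isolated_vertex_induce_subgraph nbhd_GF_graph_inner)
  ultimately show ?thesis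
    using FD unfolding extremal_GF_def by auto
next
  case FTD
  let ?G = "GF_graph k (\<lambda>u v. u < k \<and> v < k \<and> (v = Suc u \<or> u = Suc v))"
  have "is_GF k ?G {..<k}"
    using assms by (intro is_GF_path) auto
  moreover have "\<not> isolated_vertex (?G \<restriction> {..<k}) v" for v
  proof
    assume "isolated_vertex (?G \<restriction> {..<k}) v"
    then have v: "v < k" "nbhd ?G v \<inter> {..<k} = {}"
      by (simp_all add: isolated_vertex_induce_subgraph)
    from v(2) have "{w. w < k \<and> v < k \<and> w < k \<and> (w = Suc v \<or> v = Suc w)} = {}"
      by (simp only: nbhd_GF_graph_inner[OF v(1)])
    \<comment> \<open>Without a successor and a predecessor in \<open>{..<k}\<close>,
      \<open>v\<close> would be 0 and \<open>k\<close> at most 1.\<close>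
    with v(1) have "\<not> Suc v < k" and pred: "\<And>w. w < k \<Longrightarrow> v \<noteq> Suc w"
      by blast+
    then show False
      using pred[of "v - 1"] v(1) assms by (cases v) auto
  qed
  ultimately show ?thesis
    using FTD unfolding extremal_GF_def by auto
qed

text \<open>Existence is asserted over \<open>nat\<close>, since an arbitrary type \<open>'a\<close>
  may have too few elements for such a graph. \<open>H\<close> has types of its own, so the
  comparison is not confined to the types of \<open>G\<close>.\<close>

theorem theorem8:
  fixes k :: nat
  assumes "k \<ge> 5"
  shows
    "(\<forall>(G :: ('a, 'b) pre_digraph) C. is_GF k G C \<longrightarrow>
        minimum_code FD G C \<and>
        (\<not> (\<exists>v. isolated_vertex (G \<restriction> C) v) \<longleftrightarrow> admissible FTD (G \<restriction> C)) \<and>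
        (\<not> (\<exists>v. isolated_vertex (G \<restriction> C) v) \<longrightarrow> minimum_code FTD G C)) \<and>
     (\<forall>X.
        (\<exists>G :: (nat, nat \<times> nat) pre_digraph. extremal_GF X k G) \<and>
        (\<forall>G :: ('a, 'b) pre_digraph. extremal_GF X k G \<longrightarrow>
           admissible X G \<and> code_number X G = k \<and>
           (\<forall>H :: ('c, 'd) pre_digraph.
              graph H \<and> admissible X H \<and> code_number X H = k \<longrightarrow>
              code_density X G \<le> code_density X H)))"
proof (intro conjI allI impI)
  fix G :: "('a, 'b) pre_digraph" and C assume GF: "is_GF k G C"
  show "minimum_code FD G C"
    by (rule is_GF_minimum_code[OF GF assms is_GF_FD_code[OF GF]])
  show "\<not> (\<exists>v. isolated_vertex (G \<restriction> C) v) \<longleftrightarrow> admissible FTD (G \<restriction> C)"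
    by (rule is_GF_admissible_FTD_induced[OF GF])
  show "minimum_code FTD G C" if "\<not> (\<exists>v. isolated_vertex (G \<restriction> C) v)"
    by (rule is_GF_minimum_code[OF GF assms is_GF_FTD_code[OF GF that]])
next
  fix X
  show "\<exists>G :: (nat, nat \<times> nat) pre_digraph. extremal_GF X k G"
    by (rule extremal_GF_exists[OF assms])
  fix G :: "('a, 'b) pre_digraph" assume G: "extremal_GF X k G"
  show "admissible X G" "code_number X G = k"
    using extremal_GF_properties[OF G assms] by auto
  show "code_density X G \<le> code_density X H"
    if "graph H \<and> admissible X H \<and> code_number X H = k" for H :: "('c, 'd) pre_digraph"
    using extremal_GF_density_le[OF G assms] that by blast
qed

end
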